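(* Let $\mathbb{V}$ be a real normed vector space with norm $\|\cdot\|$, let $c>0$, let $\mathbb{V}_c=\{\mathbf{v}\in\mathbb{V} : \|\mathbf{v}\|<c\}$, and let $\oplus_{\mathbb{V}_c}$ be the binary operation on $\mathbb{V}_c$ given by $$\mathbf{u}\oplus_{\mathbb{V}_c}\mathbf{v}=c\,\tanh\bigl(\|A(\mathbf{u},\mathbf{v})\|\bigr)\,\frac{A(\mathbf{u},\mathbf{v})}{\|A(\mathbf{u},\mathbf{v})\|},\qquad A(\mathbf{u},\mathbf{v})=\operatorname{atanh}\!\left(\frac{\|\mathbf{u}\|}{c}\right)\frac{\mathbf{u}}{\|\mathbf{u}\|}+\operatorname{atanh}\!\left(\frac{\|\mathbf{v}\|}{c}\right)\frac{\mathbf{v}}{\|\mathbf{v}\|}.$$ Then $(\mathbb{V}_c,\oplus_{\mathbb{V}_c})$ is a commutative group.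
   Context: Conventions at the zero vector: the expression $\operatorname{atanh}(\|\mathbf{u}\|/c)\,\mathbf{u}/\|\mathbf{u}\|$ is understood to be $\mathbf{0}$ when $\mathbf{u}=\mathbf{0}$, and $c\tanh(\|\mathbf{w}\|)\,\mathbf{w}/\|\mathbf{w}\|$ is understood to be $\mathbf{0}$ when $\mathbf{w}=\mathbf{0}$. Here $\operatorname{atanh}:(-1,1)\to\mathbb{R}$ is the inverse of $\tanh$. *)

theory Defs
  imports Complex_Main "HOL-Algebra.Group"
begin

definition Vball :: "real \<Rightarrow> 'a::real_normed_vector set"
  where "Vball c = {v. norm v < c}"

(* The conventions at the zero vector need no case distinction: division by 0 is 0 in HOL, so
   u /\<^sub>R norm u = 0 for u = 0.  On the interval {-1<..<1} the library function artanh is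
   the inverse of tanh; see artanh_tanh_real in the library and tanh_artanh below. *)
definition scaled_atanh :: "real \<Rightarrow> 'a::real_normed_vector \<Rightarrow> 'a"
  where "scaled_atanh c u = artanh (norm u / c) *\<^sub>R (u /\<^sub>R norm u)"

definition scaled_tanh :: "real \<Rightarrow> 'a::real_normed_vector \<Rightarrow> 'a"
  where "scaled_tanh c w = (c * tanh (norm w)) *\<^sub>R (w /\<^sub>R norm w)"

definition Vadd :: "real \<Rightarrow> 'a::real_normed_vector \<Rightarrow> 'a \<Rightarrow> 'a"
  where "Vadd c u v = scaled_tanh c (scaled_atanh c u + scaled_atanh c v)"

(* The record type of groups has a field for the neutral element; it is filled with 0. *)
definition Vgroup :: "real \<Rightarrow> 'a::real_normed_vector monoid"
  where "Vgroup c = \<lparr>carrier = Vball c, mult = Vadd c, one = 0\<rparr>"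

lemma scaled_atanh_zero: "scaled_atanh c 0 = 0"
  by (simp add: scaled_atanh_def)

lemma scaled_tanh_zero: "scaled_tanh c 0 = 0"
  by (simp add: scaled_tanh_def)

lemma tanh_artanh:
  fixes x :: real
  assumes "-1 < x" "x < 1"
  shows "tanh (artanh x) = x"
proof -
  have "exp (- 2 * artanh x) = (1 - x) / (1 + x)"
    using assms by (simp add: artanh_def exp_minus)
  then have "tanh (artanh x) = (1 - (1 - x) / (1 + x)) / (1 + (1 - x) / (1 + x))"
    by (simp only: tanh_real_altdef)
  also have "\<dots> = x"
    using assms by (simp add: divide_simps)
  finally show ?thesis .
qed

end

(* The map scaled_tanh c is a bijection from the whole space onto the open ball of radius c, with
   inverse scaled_atanh c, and Vadd c is vector addition transported along it. *)
theory Submission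
  imports Defs
begin

text \<open>Both maps act radially: they keep directions, and on norms they are r -> c tanh r and
  its inverse, so they are mutually inverse (\<open>scaled_atanh_scaled_tanh\<close>,
  \<open>scaled_tanh_scaled_atanh\<close>). Hence the ball inherits the group laws of vector
  addition. The neutral element is 0, since both maps fix 0, and the inverse of u is -u, since
  \<open>scaled_atanh c\<close> is odd.\<close>

lemma norm_scaled_tanh:
  fixes w :: "'a::real_normed_vector"
  assumes "c > 0"
  shows "norm (scaled_tanh c w) = c * tanh (norm w)"
  using assms by (cases "w = 0") (auto simp: scaled_tanh_def abs_mult)

lemma scaled_tanh_in_Vball:
  fixes w :: "'a::real_normed_vector"
  assumes "c > 0"
  shows "scaled_tanh c w \<in> Vball c"
  using assms by (simp add: Vball_def norm_scaled_tanh tanh_real_lt_1)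

lemma scaled_atanh_scaled_tanh:
  fixes w :: "'a::real_normed_vector"
  assumes "c > 0"
  shows "scaled_atanh c (scaled_tanh c w) = w"
proof (cases "w = 0")
  case True
  then show ?thesis by (simp add: scaled_tanh_zero scaled_atanh_zero)
next
  case False
  have "scaled_atanh c (scaled_tanh c w) =
      norm w *\<^sub>R (scaled_tanh c w /\<^sub>R (c * tanh (norm w)))"
    using assms by (simp add: scaled_atanh_def norm_scaled_tanh artanh_tanh_real)
  also have "\<dots> = w"
    using assms False by (simp add: scaled_tanh_def field_simps)
  finally show ?thesis .
qed

text \<open>\<open>tanh\<close> preserves sign. This lets the norm of
  \<open>scaled_atanh c u\<close>, a priori an absolute value, be read as
  \<open>artanh (norm u / c)\<close> itself.\<close>

lemma artanh_nonneg:
  fixes x :: real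
  assumes "0 \<le> x" "x < 1"
  shows "0 \<le> artanh x"
  using assms tanh_artanh[of x] tanh_real_nonneg_iff[of "artanh x"] by simp

lemma scaled_tanh_scaled_atanh:
  fixes u :: "'a::real_normed_vector"
  assumes "c > 0" "u \<in> Vball c"
  shows "scaled_tanh c (scaled_atanh c u) = u"
proof (cases "u = 0")
  case True
  then show ?thesis by (simp add: scaled_tanh_zero scaled_atanh_zero)
next
  case False
  define x where "x = norm u / c"
  have x: "0 < x" "x < 1"
    using assms False by (auto simp: x_def Vball_def)
  have tanh: "tanh (artanh x) = x"
    using x by (intro tanh_artanh) auto
  \<comment> \<open>Normalising \<open>scaled_atanh c u\<close> cancels the factor
    \<open>artanh x\<close>, which must therefore be nonzero.\<close>
  then have "artanh x \<noteq> 0"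
    using x by auto
  moreover have "norm (scaled_atanh c u) = artanh x"
    using False x artanh_nonneg[of x] by (simp add: scaled_atanh_def flip: x_def)
  ultimately have "scaled_tanh c (scaled_atanh c u) = (c * x) *\<^sub>R (u /\<^sub>R norm u)"
    using tanh by (simp add: scaled_tanh_def) (simp add: scaled_atanh_def flip: x_def)
  also have "\<dots> = u"
    using assms False by (simp add: x_def)
  finally show ?thesis .
qed

lemma scaled_atanh_minus: "scaled_atanh c (- u) = - scaled_atanh c u"
  by (simp add: scaled_atanh_def)

theorem mainTheorem1:
  fixes c :: real
  assumes "c > 0"
  shows "comm_group (Vgroup c :: 'a::real_normed_vector monoid)"
proof (rule comm_groupI)
  fix x y z :: 'a
  let ?G = "Vgroup c :: 'a monoid"
  note defs = Vgroup_def Vadd_def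
  show "x \<otimes>\<^bsub>?G\<^esub> y \<in> carrier ?G"
    using assms by (simp add: defs scaled_tanh_in_Vball)
  show "\<one>\<^bsub>?G\<^esub> \<in> carrier ?G"
    using assms by (simp add: Vgroup_def Vball_def)
  \<comment> \<open>Applying \<open>scaled_atanh c\<close> to the inner product recovers the inner
    sum, so both sides are \<open>scaled_tanh c\<close> of the same threefold sum.\<close>
  show "x \<otimes>\<^bsub>?G\<^esub> y \<otimes>\<^bsub>?G\<^esub> z = x \<otimes>\<^bsub>?G\<^esub> (y \<otimes>\<^bsub>?G\<^esub> z)"
    using assms by (simp add: defs scaled_atanh_scaled_tanh add.assoc)
  show "x \<otimes>\<^bsub>?G\<^esub> y = y \<otimes>\<^bsub>?G\<^esub> x"
    by (simp add: defs add.commute)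
  assume x: "x \<in> carrier ?G"
  then show "\<one>\<^bsub>?G\<^esub> \<otimes>\<^bsub>?G\<^esub> x = x"
    using assms by (simp add: defs scaled_atanh_zero scaled_tanh_scaled_atanh)
  have "- x \<in> carrier ?G"
    using x by (simp add: Vgroup_def Vball_def)
  moreover have "- x \<otimes>\<^bsub>?G\<^esub> x = \<one>\<^bsub>?G\<^esub>"
    by (simp add: defs scaled_atanh_minus scaled_tanh_zero)
  ultimately show "\<exists>y\<in>carrier ?G. y \<otimes>\<^bsub>?G\<^esub> x = \<one>\<^bsub>?G\<^esub>"
    by blast
qed

end
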